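(* Let $G=(V,E)$ be a finite, simple, undirected, connected graph with a non-empty boundary vertex set $B\subseteq V$. For any weight $w\in\mathbb{R}_{+}^{|E|}$ and any $\varepsilon>0$, there exists a weight $\widetilde w\in\mathbb{R}_{+}^{|E|}$ with $|\widetilde w(e)-w(e)|<\varepsilon$ for every $e\in E$ such that all Steklov eigenvalues of $(G,B,\widetilde w)$ are simple and every Steklov eigenfunction $f\in\mathbb{R}^B$ of $(G,B,\widetilde w)$ is nonvanishing on $B$, i.e. $f(x)\ne 0$ for all $x\in B$.
   Context: $\mathbb{R}_{+}$ denotes the set of positive real numbers. A weight is a function $w:E\to\mathbb{R}_{+}$, identified with a point of $\mathbb{R}_{+}^{|E|}$; $w(x,y)$ is the weight of the edge $\{x,y\}$. Put $B^c=V\setminus B$. For $u\in\mathbb{R}^V$ and $x\in V$ set $(\Delta u)(x)=\sum_{y:\{x,y\}\in E}w(x,y)(u(x)-u(y))$, and for $x\in B$ set $(\partial_\nu u)(x)=\sum_{y:\{x,y\}\in E}w(x,y)(u(x)-u(y))$. For $f\in\mathbb{R}^B$, the harmonic extension $h_f\in\mathbb{R}^V$ is the unique function with $h_f|_B=f$ and $(\Delta h_f)(x)=0$ for all $x\in B^c$ (it exists and is unique since $G$ is connected and $B\neq\emptyset$). The Steklov operator (Dirichlet-to-Neumann map) of $(G,B,w)$ is the linear map $\Lambda:\mathbb{R}^B\to\mathbb{R}^B$, $f\mapsto\partial_\nu h_f$. Its eigenvalues are the Steklov eigenvalues and its (nonzero) eigenfunctions $f\in\mathbb{R}^B$ are the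 Steklov eigenfunctions of $(G,B,w)$. A Steklov eigenvalue is simple if its eigenspace is one-dimensional. *)

theory Defs
  imports "HOL-Analysis.Analysis"
begin

text \<open>
  The vertex set \<open>V\<close> is the universe of a finite type \<open>'v\<close>, so that \<open>\<real>\<^sup>V\<close> is the
  Euclidean space \<open>real ^ 'v\<close>.  An undirected edge is the two-element set of its endpoints,
  hence an edge weight \<open>w :: 'v set \<Rightarrow> real\<close> is automatically symmetric; its values outside
  the edge set are irrelevant.
\<close>

definition simple_graph :: "'v set set \<Rightarrow> bool" where
  "simple_graph E \<longleftrightarrow> (\<forall>e\<in>E. card e = 2)"

definition adjacency :: "'v set set \<Rightarrow> ('v \<times> 'v) set" where
  "adjacency E = {(x, y). {x, y} \<in> E}"

definition connected_graph :: "'v set set \<Rightarrow> bool" where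
  "connected_graph E \<longleftrightarrow> (\<forall>x y. (x, y) \<in> (adjacency E)\<^sup>*)"

definition weight :: "'v set set \<Rightarrow> ('v set \<Rightarrow> real) \<Rightarrow> bool" where
  "weight E w \<longleftrightarrow> (\<forall>e\<in>E. w e > 0)"

definition laplacian :: "'v::finite set set \<Rightarrow> ('v set \<Rightarrow> real) \<Rightarrow> real ^ 'v \<Rightarrow> real ^ 'v" where
  "laplacian E w u = (\<chi> x. \<Sum>y | {x, y} \<in> E. w {x, y} * (u $ x - u $ y))"

text \<open>
  \<open>\<real>\<^sup>B\<close> is identified with the coordinate subspace of the vectors that vanish off \<open>B\<close>.
\<close>

definition boundary_space :: "'v::finite set \<Rightarrow> (real ^ 'v) set" where
  "boundary_space B = {f. \<forall>x. x \<notin> B \<longrightarrow> f $ x = 0}"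

definition normal_derivative ::
    "'v::finite set set \<Rightarrow> 'v set \<Rightarrow> ('v set \<Rightarrow> real) \<Rightarrow> real ^ 'v \<Rightarrow> real ^ 'v" where
  "normal_derivative E B w u =
    (\<chi> x. if x \<in> B then \<Sum>y | {x, y} \<in> E. w {x, y} * (u $ x - u $ y) else 0)"

definition is_harmonic_extension ::
    "'v::finite set set \<Rightarrow> 'v set \<Rightarrow> ('v set \<Rightarrow> real) \<Rightarrow> real ^ 'v \<Rightarrow> real ^ 'v \<Rightarrow> bool" where
  "is_harmonic_extension E B w f u \<longleftrightarrow>
    (\<forall>x\<in>B. u $ x = f $ x) \<and> (\<forall>x\<in>-B. laplacian E w u $ x = 0)"

definition harmonic_extension ::
    "'v::finite set set \<Rightarrow> 'v set \<Rightarrow> ('v set \<Rightarrow> real) \<Rightarrow> real ^ 'v \<Rightarrow> real ^ 'v" where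
  "harmonic_extension E B w f = (THE u. is_harmonic_extension E B w f u)"

definition steklov_operator ::
    "'v::finite set set \<Rightarrow> 'v set \<Rightarrow> ('v set \<Rightarrow> real) \<Rightarrow> real ^ 'v \<Rightarrow> real ^ 'v" where
  "steklov_operator E B w f = normal_derivative E B w (harmonic_extension E B w f)"

definition steklov_eigenspace ::
    "'v::finite set set \<Rightarrow> 'v set \<Rightarrow> ('v set \<Rightarrow> real) \<Rightarrow> real \<Rightarrow> (real ^ 'v) set" where
  "steklov_eigenspace E B w \<mu> = {f \<in> boundary_space B. steklov_operator E B w f = \<mu> *\<^sub>R f}"

definition steklov_eigenvalue ::
    "'v::finite set set \<Rightarrow> 'v set \<Rightarrow> ('v set \<Rightarrow> real) \<Rightarrow> real \<Rightarrow> bool" where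
  "steklov_eigenvalue E B w \<mu> \<longleftrightarrow> (\<exists>f \<in> steklov_eigenspace E B w \<mu>. f \<noteq> 0)"

definition steklov_eigenfunction ::
    "'v::finite set set \<Rightarrow> 'v set \<Rightarrow> ('v set \<Rightarrow> real) \<Rightarrow> real ^ 'v \<Rightarrow> bool" where
  "steklov_eigenfunction E B w f \<longleftrightarrow> f \<noteq> 0 \<and> (\<exists>\<mu>. f \<in> steklov_eigenspace E B w \<mu>)"

definition simple_steklov_eigenvalue ::
    "'v::finite set set \<Rightarrow> 'v set \<Rightarrow> ('v set \<Rightarrow> real) \<Rightarrow> real \<Rightarrow> bool" where
  "simple_steklov_eigenvalue E B w \<mu> \<longleftrightarrow>
    steklov_eigenvalue E B w \<mu> \<and> dim (steklov_eigenspace E B w \<mu>) = 1"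

text \<open>The harmonic extension is well defined, so the description operator above is not junk.\<close>

lemma laplacian_energy:
  fixes u :: "real ^ 'v::finite"
  shows "2 * (\<Sum>x\<in>UNIV. u $ x * laplacian E w u $ x) =
    (\<Sum>x\<in>UNIV. \<Sum>y\<in>UNIV. if {x, y} \<in> E then w {x, y} * (u $ x - u $ y)\<^sup>2 else 0)"
proof -
  let ?g = "\<lambda>x y. if {x, y} \<in> E then u $ x * (w {x, y} * (u $ x - u $ y)) else 0"
  have "(\<Sum>x\<in>UNIV. u $ x * laplacian E w u $ x) = (\<Sum>x\<in>UNIV. \<Sum>y\<in>UNIV. ?g x y)" (is "?A = _")
    by (simp add: laplacian_def sum_distrib_left sum.If_cases)
  moreover have "(\<Sum>x\<in>UNIV. \<Sum>y\<in>UNIV. ?g x y) = (\<Sum>x\<in>UNIV. \<Sum>y\<in>UNIV. ?g y x)"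
    by (rule sum.swap)
  ultimately have "2 * ?A = (\<Sum>x\<in>UNIV. \<Sum>y\<in>UNIV. ?g x y + ?g y x)"
    by (simp add: sum.distrib)
  also have "\<dots> = (\<Sum>x\<in>UNIV. \<Sum>y\<in>UNIV.
      if {x, y} \<in> E then w {x, y} * (u $ x - u $ y)\<^sup>2 else 0)"
    by (intro sum.cong refl) (auto simp: insert_commute power2_eq_square algebra_simps)
  finally show ?thesis .
qed

lemma harmonic_extension_ex1:
  fixes E :: "'v::finite set set"
  assumes "connected_graph E" and "weight E w" and "B \<noteq> {}"
  shows "\<exists>!u. is_harmonic_extension E B w f u"
proof -
  define T :: "real ^ 'v \<Rightarrow> real ^ 'v"
    where "T u = (\<chi> x. if x \<in> B then u $ x else laplacian E w u $ x)" for u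
  have lin: "linear T"
    by (rule linearI)
      (auto simp: T_def vec_eq_iff laplacian_def sum.distrib[symmetric] sum_distrib_left
        algebra_simps intro!: sum.cong)
  have "u = 0" if "T u = 0" for u
  proof -
    have *: "(if x \<in> B then u $ x else laplacian E w u $ x) = 0" for x
      using that by (simp add: T_def vec_eq_iff)
    define G where "G x y = (if {x, y} \<in> E then w {x, y} * (u $ x - u $ y)\<^sup>2 else 0)" for x y
    have "u $ x * laplacian E w u $ x = 0" for x
      using *[of x] by (auto split: if_splits)
    then have "(\<Sum>x\<in>UNIV. u $ x * laplacian E w u $ x) = 0"
      by (intro sum.neutral) blast
    then have total: "(\<Sum>x\<in>UNIV. \<Sum>y\<in>UNIV. G x y) = 0"
      using laplacian_energy[of u E w] unfolding G_def by linarith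
    have nonneg: "0 \<le> G x y" for x y
      using assms(2) by (simp add: G_def weight_def less_imp_le)
    have "(\<Sum>y\<in>UNIV. G x y) = 0" for x
      using total sum_nonneg_eq_0_iff[of UNIV "\<lambda>x. \<Sum>y\<in>UNIV. G x y"]
      by (simp add: nonneg sum_nonneg)
    then have zero: "G x y = 0" for x y
      using sum_nonneg_eq_0_iff[of UNIV "G x"] by (simp add: nonneg)
    have edge: "u $ x = u $ y" if "(x, y) \<in> adjacency E" for x y
      using that zero[of x y] assms(2) by (auto simp: G_def adjacency_def weight_def)
    have path: "u $ x = u $ y" if "(x, y) \<in> (adjacency E)\<^sup>*" for x y
      using that by (induction rule: rtrancl_induct) (auto dest: edge)
    obtain b where "b \<in> B" using assms(3) by blast
    with * [of b] have "u $ b = 0" by simp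
    then show "u = 0"
      using path assms(1) by (metis connected_graph_def vec_eq_iff zero_index)
  qed
  then have "inj T" using linear_injective_0[OF lin] by blast
  then have "bij T"
    using linear_injective_imp_surjective[OF lin] by (simp add: bij_def)
  then have "\<exists>!u. T u = (\<chi> x. if x \<in> B then f $ x else 0)"
    by (simp add: bij_iff)
  moreover have "T u = (\<chi> x. if x \<in> B then f $ x else 0) \<longleftrightarrow> is_harmonic_extension E B w f u" for u
    by (auto simp: T_def vec_eq_iff is_harmonic_extension_def)
  ultimately show ?thesis by simp
qed

end

theory Submission
  imports Defs
begin

text \<open>
  If every Steklov eigenfunction is nonzero at \<open>x \<in> B\<close>, then every eigenvalue is simple, because
  an eigenspace of dimension two contains a nonzero function vanishing at \<open>x\<close>.  So only vanishing
  has to be excluded.  By symmetry, no eigenfunction vanishes at \<open>x\<close> if and only if the Krylov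
  vectors of \<open>x\<close> span \<open>\<real>\<^sup>B\<close>, and along a line of weights this is the nonvanishing of a polynomial;
  hence it fails only for finitely many points of the line as soon as it holds at one.  It holds
  for some weight supported on a spanning tree: the tree is grown leaf by leaf, and each new leaf
  edge has only finitely many bad weights.  Moving successively, for every \<open>x \<in> B\<close>, a short
  distance towards such a tree weight gives the theorem.
\<close>

section \<open>Eigenvectors and Krylov vectors of self-adjoint operators\<close>

text \<open>A maximiser of the Rayleigh quotient on the unit sphere of \<open>W\<close> is an
  eigenvector. Symmetry is assumed only on \<open>W\<close>, because the operators used later are
  symmetric only on a subspace.\<close>

lemma self_adjoint_eigenvector:
  fixes T :: "'a::euclidean_space \<Rightarrow> 'a"
  assumes lin: "linear T" and W: "subspace W" "W \<noteq> {0}"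
    and inv: "\<And>z. z \<in> W \<Longrightarrow> T z \<in> W"
    and sym: "\<And>y z. y \<in> W \<Longrightarrow> z \<in> W \<Longrightarrow> y \<bullet> T z = T y \<bullet> z"
  obtains z \<nu> where "z \<in> W" "z \<noteq> 0" "T z = \<nu> *\<^sub>R z"
proof -
  let ?S = "W \<inter> sphere 0 1"
  have "compact ?S"
    using closed_subspace[OF W(1)] by (simp add: closed_Int_compact)
  moreover have "?S \<noteq> {}"
  proof -
    obtain a where a: "a \<in> W" "a \<noteq> 0"
      using W subspace_0 by blast
    then have "a /\<^sub>R norm a \<in> ?S"
      using W(1) by (simp add: subspace_scale)
    then show ?thesis by blast
  qed
  moreover have "continuous_on ?S (\<lambda>z. z \<bullet> T z)"
    by (intro continuous_intros linear_continuous_on linear_conv_bounded_linear[THEN iffD1] lin)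
  ultimately obtain z where z: "z \<in> ?S" and max: "\<And>y. y \<in> ?S \<Longrightarrow> y \<bullet> T y \<le> z \<bullet> T z"
    using continuous_attains_sup[of ?S "\<lambda>z. z \<bullet> T z"] by blast
  define \<nu> where "\<nu> = z \<bullet> T z"
  have zz: "z \<bullet> z = 1" and zW: "z \<in> W"
    using z by (auto simp: dot_square_norm)
  have bound: "y \<bullet> T y \<le> \<nu> * (y \<bullet> y)" if "y \<in> W" for y
  proof (cases "y = 0")
    case True
    then show ?thesis using linear_0[OF lin] by simp
  next
    case False
    have "y /\<^sub>R norm y \<in> ?S"
      using that False W(1) by (simp add: subspace_scale)
    from max[OF this] have "(y \<bullet> T y) / (norm y)\<^sup>2 \<le> \<nu>"
      by (simp add: linear_scale[OF lin] \<nu>_def power2_eq_square divide_simps)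
    then show ?thesis
      using False by (simp add: dot_square_norm field_simps)
  qed
  define h where "h = T z - \<nu> *\<^sub>R z"
  have hW: "h \<in> W"
    unfolding h_def using zW inv W(1) by (intro subspace_diff subspace_scale) auto
  have zh: "z \<bullet> T h = T z \<bullet> h"
    using sym zW hW by blast
  \<comment> \<open>Moving the maximiser along its residual \<open>h\<close> gains
    \<open>2 * e * (h \<bullet> h)\<close> to first order, while the remaining terms are quadratic
    in \<open>e\<close>.\<close>
  have quad: "2 * e * (h \<bullet> h) \<le> e\<^sup>2 * (\<nu> * (h \<bullet> h) - h \<bullet> T h)" for e
  proof -
    have "z + e *\<^sub>R h \<in> W"
      using zW hW W(1) by (intro subspace_add subspace_scale)
    from bound[OF this] have
      "z \<bullet> T z + e * (z \<bullet> T h + h \<bullet> T z) + e\<^sup>2 * (h \<bullet> T h)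
        \<le> \<nu> * (z \<bullet> z + 2 * e * (z \<bullet> h) + e\<^sup>2 * (h \<bullet> h))"
      by (simp add: linear_add[OF lin] linear_scale[OF lin] inner_simps inner_commute
          power2_eq_square algebra_simps)
    moreover have "h \<bullet> T z = h \<bullet> h + \<nu> * (z \<bullet> h)"
      by (simp add: h_def inner_diff_right inner_diff_left inner_commute algebra_simps)
    moreover have "z \<bullet> T h = h \<bullet> h + \<nu> * (z \<bullet> h)"
      using zh calculation(2) by (simp add: inner_commute)
    ultimately show ?thesis
      by (simp add: zz \<nu>_def[symmetric] distrib_left right_diff_distrib mult.assoc mult.left_commute)
  qed
  have "h \<bullet> h \<le> 0"
  proof (rule ccontr)
    assume "\<not> h \<bullet> h \<le> 0"
    \<comment> \<open>The \<open>+ 1\<close> makes this bound on the quadratic coefficient positive;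
      with \<open>e = (h \<bullet> h) / d\<close>, \<open>quad\<close> yields
      \<open>2 * e * (h \<bullet> h) \<le> e * (h \<bullet> h)\<close>.\<close>
    define d where "d = \<bar>\<nu> * (h \<bullet> h) - h \<bullet> T h\<bar> + 1"
    have d: "d > 0" "\<nu> * (h \<bullet> h) - h \<bullet> T h \<le> d" by (auto simp: d_def)
    define e where "e = (h \<bullet> h) / d"
    have e: "e > 0"
      unfolding e_def using d \<open>\<not> h \<bullet> h \<le> 0\<close> by (intro divide_pos_pos) linarith+
    have "2 * e * (h \<bullet> h) \<le> e\<^sup>2 * d"
      using quad[of e] mult_left_mono[OF d(2), of "e\<^sup>2"] by simp
    also have "e\<^sup>2 * d = e * (h \<bullet> h)"
      using d by (simp add: e_def power2_eq_square)
    finally show False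
      using e \<open>\<not> h \<bullet> h \<le> 0\<close> by (simp add: mult_le_cancel_right)
  qed
  then have "h = 0"
    using inner_ge_zero[of h] inner_eq_zero_iff[of h] by linarith
  then have "T z = \<nu> *\<^sub>R z"
    by (simp add: h_def)
  moreover have "z \<noteq> 0" using zz by auto
  ultimately show thesis using that zW by blast
qed

text \<open>
  The orthogonal complement of all Krylov vectors is invariant under \<open>T\<close>, so it contains an
  eigenvector unless it is trivial; by dimension finitely many Krylov vectors suffice.
\<close>

lemma finite_krylov_separation:
  fixes T :: "'a::euclidean_space \<Rightarrow> 'a"
  assumes lin: "linear T" and W: "subspace W" and b: "b \<in> W"
    and inv: "\<And>z. z \<in> W \<Longrightarrow> T z \<in> W"
    and sym: "\<And>y z. y \<in> W \<Longrightarrow> z \<in> W \<Longrightarrow> y \<bullet> T z = T y \<bullet> z"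
    and no_eig: "\<And>z \<nu>. z \<in> W \<Longrightarrow> T z = \<nu> *\<^sub>R z \<Longrightarrow> z \<bullet> b = 0 \<Longrightarrow> z = 0"
  shows "\<exists>n. \<forall>z\<in>W. (\<forall>i<n. z \<bullet> (T ^^ i) b = 0) \<longrightarrow> z = 0"
proof -
  define K where "K n = {z \<in> W. \<forall>i<n. z \<bullet> (T ^^ i) b = 0}" for n
  have sub: "subspace (K n)" for n
    using W by (auto simp: K_def subspace_def inner_simps)
  \<comment> \<open>The spaces \<open>K n\<close> decrease, so they are constant from an index of
    least dimension on.\<close>
  obtain n where n: "\<And>m. dim (K n) \<le> dim (K m)"
    using ex_has_least_nat[of "\<lambda>_. True" 0 "\<lambda>m. dim (K m)"] by blast
  have stable: "K n = K m" if "n \<le> m" for m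
  proof -
    have "K m \<subseteq> K n" using that by (auto simp: K_def)
    then show ?thesis using subspace_dim_equal[OF sub sub _ n] by blast
  qed
  have perp: "z \<bullet> (T ^^ i) b = 0" if "z \<in> K n" for z i
  proof -
    have "z \<in> K (max n (Suc i))" using stable[of "max n (Suc i)"] that by simp
    then show ?thesis by (auto simp: K_def)
  qed
  have iter: "(T ^^ i) b \<in> W" for i
    using b inv by (induction i) auto
  have Kinv: "T z \<in> K n" if "z \<in> K n" for z
  proof -
    have zW: "z \<in> W" using that by (simp add: K_def)
    have "T z \<bullet> (T ^^ i) b = z \<bullet> (T ^^ Suc i) b" for i
      using sym[OF zW iter] by simp
    then show ?thesis
      using perp[OF that] inv[OF zW] by (simp add: K_def del: funpow.simps)
  qed
  have "K n = {0}"
  proof (rule ccontr)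
    assume ne: "K n \<noteq> {0}"
    have symK: "y \<bullet> T z = T y \<bullet> z" if "y \<in> K n" "z \<in> K n" for y z
      using sym that by (simp add: K_def)
    obtain z \<nu> where z: "z \<in> K n" "z \<noteq> 0" "T z = \<nu> *\<^sub>R z"
      using self_adjoint_eigenvector[OF lin sub ne Kinv symK] by blast
    moreover have "z \<in> W" "z \<bullet> b = 0"
      using z(1) perp[OF z(1), of 0] by (auto simp: K_def)
    ultimately show False using no_eig by blast
  qed
  then show ?thesis unfolding K_def by blast
qed

section \<open>Polynomial dependence on a parameter and Cramer's rule\<close>

lemma real_polynomial_function_If:
  "real_polynomial_function f \<Longrightarrow> real_polynomial_function g \<Longrightarrow>
    real_polynomial_function (\<lambda>t. if P then f t else g t)"
  by (cases P) auto

lemma real_polynomial_function_det: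
  fixes A :: "'a::real_normed_vector \<Rightarrow> real ^ 'n ^ 'n"
  assumes "\<And>i j. real_polynomial_function (\<lambda>t. A t $ i $ j)"
  shows "real_polynomial_function (\<lambda>t. det (A t))"
  unfolding det_def using assms
  by (intro real_polynomial_function_sum real_polynomial_function.intros(2,4)
      real_polynomial_function_prod) (auto simp: finite_permutations)

lemma finite_zeros_real_polynomial_function:
  fixes f :: "real \<Rightarrow> real"
  assumes "real_polynomial_function f" and "f t\<^sub>0 \<noteq> 0"
  shows "finite {t. f t = 0}"
proof -
  obtain a n where f: "f = (\<lambda>x. \<Sum>i\<le>n. a i * x ^ i)"
    using assms(1) real_polynomial_function_iff_sum by blast
  then have "\<exists>i\<le>n. a i \<noteq> 0"
    using assms(2) by (metis (no_types, lifting) mult_zero_left sum.neutral atMost_iff)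
  then show ?thesis
    unfolding f by (subst polyfun_finite_roots)
qed

lemma det_matrix_eq_0_iff:
  fixes M :: "real ^ 'n \<Rightarrow> real ^ 'n"
  assumes "linear M"
  shows "det (matrix M) = 0 \<longleftrightarrow> (\<exists>z. z \<noteq> 0 \<and> M z = 0)"
proof -
  have "det (matrix M) \<noteq> 0 \<longleftrightarrow> (\<forall>z. matrix M *v z = 0 \<longrightarrow> z = 0)"
    by (simp flip: invertible_det_nz add: invertible_left_inverse matrix_left_invertible_ker)
  then show ?thesis
    using matrix_works assms by (metis linear_matrix_vector_mul_eq)
qed

text \<open>Singularity is the vanishing of the determinant, a polynomial in \<open>t\<close> that
  is nonzero at \<open>t\<^sub>0\<close>.\<close>

lemma finite_singular_parameters:
  fixes M :: "real \<Rightarrow> real ^ 'n \<Rightarrow> real ^ 'n"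
  assumes lin: "\<And>t. linear (M t)"
    and pol: "\<And>z i. real_polynomial_function (\<lambda>t. M t z $ i)"
    and inj: "\<And>z. M t\<^sub>0 z = 0 \<Longrightarrow> z = 0"
  shows "finite {t. \<exists>z. z \<noteq> 0 \<and> M t z = 0}"
proof -
  have "real_polynomial_function (\<lambda>t. det (matrix (M t)))"
    by (rule real_polynomial_function_det) (simp add: matrix_def pol)
  moreover have "det (matrix (M t\<^sub>0)) \<noteq> 0"
    using det_matrix_eq_0_iff[OF lin] inj by blast
  ultimately show ?thesis
    unfolding det_matrix_eq_0_iff[OF lin, symmetric]
    by (rule finite_zeros_real_polynomial_function)
qed

text \<open>The adjugate of \<open>A\<close> applied to \<open>b\<close>: Cramer's rule before the
  division by \<open>det A\<close>, so that the entries are polynomials in those of \<open>A\<close>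
  and \<open>b\<close>.\<close>

definition cramer_numerator :: "real ^ 'n ^ 'n \<Rightarrow> real ^ 'n \<Rightarrow> real ^ 'n" where
  "cramer_numerator A b = (\<chi> k. det (\<chi> i j. if j = k then b $ i else A $ i $ j))"

lemma matrix_cramer_numerator:
  assumes "det A \<noteq> 0"
  shows "A *v cramer_numerator A b = det A *\<^sub>R b"
proof -
  have "cramer_numerator A b /\<^sub>R det A =
      (\<chi> k. det (\<chi> i j. if j = k then b $ i else A $ i $ j) / det A)"
    by (simp add: cramer_numerator_def vec_eq_iff divide_inverse_commute)
  then have "A *v (cramer_numerator A b /\<^sub>R det A) = b"
    using cramer[OF assms] by blast
  then have "det A *\<^sub>R ((A *v cramer_numerator A b) /\<^sub>R det A) = det A *\<^sub>R b"
    by (simp only: matrix_vector_mult_scaleR)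
  then show ?thesis
    using assms by simp
qed

text \<open>Both sides have the same image under the injective map given by
  \<open>A\<close>.\<close>

lemma linear_cramer_numerator:
  assumes "det A \<noteq> 0"
  shows "linear (cramer_numerator A)"
proof (rule linearI)
  have cancel: "a = b" if "A *v a = A *v b" for a b
    using that cramer[OF assms, of a "A *v b"] cramer[OF assms, of b "A *v b"] by simp
  show "cramer_numerator A (b + c) = cramer_numerator A b + cramer_numerator A c" for b c
    by (rule cancel)
      (simp only: matrix_cramer_numerator[OF assms] matrix_vector_right_distrib scaleR_add_right)
  show "cramer_numerator A (r *\<^sub>R b) = r *\<^sub>R cramer_numerator A b" for r b
    by (rule cancel)
      (simp only: matrix_cramer_numerator[OF assms] matrix_vector_mult_scaleR scaleR_scaleR mult.commute)
qed

section \<open>Restriction to the boundary and symmetry of the Laplacian\<close>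

text \<open>The orthogonal projection onto \<open>boundary_space B\<close>, kept as a map on the
  whole space so that it can be added to the Laplacian.\<close>

definition restriction :: "'v set \<Rightarrow> real ^ 'v \<Rightarrow> real ^ 'v" where
  "restriction B u = (\<chi> y. if y \<in> B then u $ y else 0)"

lemma restriction_nth [simp]: "restriction B u $ y = (if y \<in> B then u $ y else 0)"
  by (simp add: restriction_def)

lemma restriction_in_boundary_space [simp]: "restriction B u \<in> boundary_space B"
  by (simp add: boundary_space_def)

lemma restriction_boundary_space: "f \<in> boundary_space B \<Longrightarrow> restriction B f = f"
  by (auto simp: boundary_space_def vec_eq_iff)

lemma restriction_eq_iff: "restriction B f = f \<longleftrightarrow> f \<in> boundary_space B"
  by (metis restriction_boundary_space restriction_in_boundary_space)

lemma linear_restriction: "linear (restriction B)"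
  by (rule linearI) (auto simp: vec_eq_iff)

lemma restriction_inner: "restriction B a \<bullet> b = a \<bullet> restriction B b"
  by (auto simp: inner_vec_def intro!: sum.cong)

lemma subspace_boundary_space: "subspace (boundary_space B)"
  by (auto simp: subspace_def boundary_space_def)

lemma laplacian_nth:
  "laplacian E w u $ x = (\<Sum>y\<in>UNIV. if {x, y} \<in> E then w {x, y} * (u $ x - u $ y) else 0)"
  by (simp add: laplacian_def sum.If_cases)

lemma linear_laplacian: "linear (laplacian E w)"
  by (rule linearI)
    (auto simp: vec_eq_iff laplacian_def sum.distrib[symmetric] sum_distrib_left
      algebra_simps intro!: sum.cong)

text \<open>Edge weights are symmetric, so exchanging the two summations exchanges \<open>a\<close>
  and \<open>b\<close> in the mixed terms; the diagonal terms are symmetric already.\<close>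

lemma laplacian_inner: "a \<bullet> laplacian E w b = laplacian E w a \<bullet> b"
proof -
  define g where "g x y = (if {x, y} \<in> E then w {x, y} else 0)" for x y
  have g: "g x y = g y x" for x y
    by (simp add: g_def insert_commute)
  have L: "laplacian E w u $ x = (\<Sum>y\<in>UNIV. g x y * (u $ x - u $ y))" for u x
    unfolding laplacian_nth g_def by (rule sum.cong) auto
  have expand: "u \<bullet> laplacian E w v =
      (\<Sum>x\<in>UNIV. \<Sum>y\<in>UNIV. g x y * (u $ x * v $ x)) -
      (\<Sum>x\<in>UNIV. \<Sum>y\<in>UNIV. g x y * (u $ x * v $ y))"
    for u v
    unfolding inner_vec_def L
    by (simp add: sum_distrib_left sum_subtractf[symmetric] algebra_simps)
  have "(\<Sum>x\<in>UNIV. \<Sum>y\<in>UNIV. g x y * (a $ x * b $ y)) =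
      (\<Sum>x\<in>UNIV. \<Sum>y\<in>UNIV. g x y * (b $ x * a $ y))"
    by (subst sum.swap) (auto simp: g mult.commute intro!: sum.cong)
  then show ?thesis
    unfolding inner_commute[of "laplacian E w a"] expand by (simp add: mult.commute mult.left_commute)
qed

text \<open>Constants lie in the kernel, and the Laplacian is symmetric.\<close>

lemma sum_laplacian: "(\<Sum>x\<in>UNIV. laplacian E w u $ x) = 0"
proof -
  have "laplacian E w 1 = 0"
    by (simp add: vec_eq_iff laplacian_def)
  then show ?thesis
    using laplacian_inner[of 1 E w u] by (simp add: inner_vec_def)
qed

text \<open>Weights may vanish here, so zero energy need not make \<open>u\<close> constant; it
  still kills every term \<open>w {x, y} * (u $ x - u $ y)\<close> of the Laplacian.\<close>

lemma
  assumes "\<And>e. e \<in> E \<Longrightarrow> w e \<ge> 0"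
  shows laplacian_inner_nonneg: "u \<bullet> laplacian E w u \<ge> 0"
    and laplacian_inner_eq_0: "u \<bullet> laplacian E w u = 0 \<Longrightarrow> laplacian E w u = 0"
proof -
  define G where "G x y = (if {x, y} \<in> E then w {x, y} * (u $ x - u $ y)\<^sup>2 else 0)" for x y
  have nonneg: "G x y \<ge> 0" for x y
    using assms by (simp add: G_def)
  have total: "2 * (u \<bullet> laplacian E w u) = (\<Sum>x\<in>UNIV. \<Sum>y\<in>UNIV. G x y)"
    using laplacian_energy[of u E w] by (simp add: inner_vec_def G_def)
  moreover have "(\<Sum>x\<in>UNIV. \<Sum>y\<in>UNIV. G x y) \<ge> 0"
    by (intro sum_nonneg nonneg)
  ultimately show "u \<bullet> laplacian E w u \<ge> 0"
    by linarith
  assume "u \<bullet> laplacian E w u = 0"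
  with total have "(\<Sum>y\<in>UNIV. G x y) = 0" for x
    using sum_nonneg_eq_0_iff[of UNIV "\<lambda>x. \<Sum>y\<in>UNIV. G x y"] by (simp add: nonneg sum_nonneg)
  then have "G x y = 0" for x y
    using sum_nonneg_eq_0_iff[of UNIV "G x"] by (simp add: nonneg)
  then have "w {x, y} * (u $ x - u $ y) = 0" if "{x, y} \<in> E" for x y
    using that by (metis G_def mult_eq_0_iff power_eq_0_iff)
  then show "laplacian E w u = 0"
    by (auto simp: vec_eq_iff laplacian_def intro!: sum.neutral)
qed

section \<open>Observability along a line of weights\<close>

text \<open>
  For positive weights, \<open>observable E B w x\<close> with \<open>x \<in> B\<close> says that no Steklov eigenfunction
  vanishes at \<open>x\<close>, but in terms of the eigenvalue problem on all of \<open>V\<close>; unlike the Steklov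
  operator, this makes sense for degenerate weights, too.
\<close>

definition observable :: "'v::finite set set \<Rightarrow> 'v set \<Rightarrow> ('v set \<Rightarrow> real) \<Rightarrow> 'v \<Rightarrow> bool" where
  "observable E B w x \<longleftrightarrow>
    (\<forall>\<mu> u. laplacian E w u = \<mu> *\<^sub>R restriction B u \<longrightarrow> u $ x = 0 \<longrightarrow> u = 0)"

lemma observableD:
  "observable E B w x \<Longrightarrow> laplacian E w u = \<mu> *\<^sub>R restriction B u \<Longrightarrow> u $ x = 0 \<Longrightarrow> u = 0"
  unfolding observable_def by blast

text \<open>
  Writing \<open>P\<close> for the restriction to \<open>B\<close>, the equation \<open>L u = \<mu> P u\<close> is equivalent to
  \<open>(L + P) u = (\<mu> + 1) P u\<close>, so up to the factor \<open>det (L + P)\<close> the operator \<open>T = P adj(L + P) P\<close>,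
  whose entries are polynomials in \<open>t\<close>, has the eigenfunctions of the Steklov operator.  The map
  \<open>G\<close> is the Gram operator of the Krylov vectors, completed by the identity off \<open>B\<close>.
\<close>

lemma finite_unobservable_on_line:
  fixes E :: "'v::finite set set" and a b :: "'v set \<Rightarrow> real"
  defines "w \<equiv> \<lambda>t e. a e + t * b e"
  assumes x: "x \<in> B" and nonneg: "\<And>e. e \<in> E \<Longrightarrow> w t\<^sub>0 e \<ge> 0" and obs: "observable E B (w t\<^sub>0) x"
  shows "finite {t. \<not> observable E B (w t) x}"
proof -
  define C where "C t u = laplacian E (w t) u + restriction B u" for t u
  have linC: "linear (C t)" for t
    unfolding C_def by (intro linear_compose_add linear_laplacian linear_restriction)
  have symC: "y \<bullet> C t z = C t y \<bullet> z" for t y z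
    by (simp add: C_def inner_simps laplacian_inner restriction_inner)
  have polC: "real_polynomial_function (\<lambda>t. C t z $ i)" for z i
    unfolding C_def w_def
    by (auto simp: laplacian_nth intro!: real_polynomial_function_If
        real_polynomial_function.intros(2-4)
        real_polynomial_function_sum real_polynomial_function.intros(1)[OF bounded_linear_ident])
  have posC: "z \<bullet> C t\<^sub>0 z = z \<bullet> laplacian E (w t\<^sub>0) z + (norm (restriction B z))\<^sup>2" for z
    by (simp add: C_def inner_simps power2_norm_eq_inner restriction_inner restriction_boundary_space)
  have L_nonneg: "z \<bullet> laplacian E (w t\<^sub>0) z \<ge> 0" for z
    by (rule laplacian_inner_nonneg) (rule nonneg)
  have L_eq_0: "laplacian E (w t\<^sub>0) z = 0" if "z \<bullet> laplacian E (w t\<^sub>0) z = 0" for z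
    by (rule laplacian_inner_eq_0[OF _ that]) (rule nonneg)
  have posC': "laplacian E (w t\<^sub>0) z = 0 \<and> restriction B z = 0" if "z \<bullet> C t\<^sub>0 z = 0" for z
  proof -
    have "z \<bullet> laplacian E (w t\<^sub>0) z = 0" "(norm (restriction B z))\<^sup>2 = 0"
      using posC[of z] that L_nonneg[of z] zero_le_power2[of "norm (restriction B z)"] by linarith+
    then show ?thesis
      using L_eq_0 by simp
  qed
  \<comment> \<open>The weight at \<open>t\<^sub>0\<close> may be degenerate, so injectivity comes
    from observability with eigenvalue 0 rather than from connectedness.\<close>
  have injC: "z = 0" if "C t\<^sub>0 z = 0" for z
  proof -
    have *: "laplacian E (w t\<^sub>0) z = 0" "restriction B z = 0"
      using posC'[of z] that by auto
    moreover have "z $ x = 0"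
      using arg_cong[OF *(2), of "\<lambda>f. f $ x"] x by simp
    ultimately show "z = 0"
      using observableD[OF obs, of z 0] by simp
  qed
  define d where "d t = det (matrix (C t))" for t
  define T where "T t f = restriction B (cramer_numerator (matrix (C t)) f)" for t f
  have d: "d t \<noteq> 0 \<longleftrightarrow> (\<forall>z. C t z = 0 \<longrightarrow> z = 0)" for t
    unfolding d_def using det_matrix_eq_0_iff[OF linC] by blast
  have mat: "matrix (C t) *v f = C t f" for t f
    using matrix_works[of "C t" f] linC[of t] by (simp add: linear_matrix_vector_mul_eq)
  have C_num: "C t (cramer_numerator (matrix (C t)) f) = d t *\<^sub>R f" if "d t \<noteq> 0" for t f
    using matrix_cramer_numerator[of "matrix (C t)" f] that unfolding d_def mat by blast
  have linT: "linear (T t)" if "d t \<noteq> 0" for t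
    using linear_compose[OF linear_cramer_numerator linear_restriction, of "matrix (C t)" B] that
    unfolding T_def d_def by (simp add: o_def)
  have symT: "y \<bullet> T t z = T t y \<bullet> z"
    if "d t \<noteq> 0" "y \<in> boundary_space B" "z \<in> boundary_space B" for t y z
  proof -
    let ?S = "cramer_numerator (matrix (C t))"
    have "d t * (y \<bullet> T t z) = (d t *\<^sub>R y) \<bullet> ?S z"
      using that by (simp add: T_def restriction_boundary_space flip: restriction_inner)
    also have "\<dots> = ?S y \<bullet> C t (?S z)"
      using that(1) by (simp add: C_num[symmetric] symC)
    also have "\<dots> = d t * (T t y \<bullet> z)"
      using that by (simp add: C_num T_def restriction_boundary_space restriction_inner)
    finally show ?thesis using that(1) by simp
  qed
  define v where "v t i = (T t ^^ i) (axis x 1)" for t i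
  have b: "axis x 1 \<in> boundary_space B"
    using x by (auto simp: boundary_space_def axis_def)
  have polv: "real_polynomial_function (\<lambda>t. v t i $ k)" for i k
  proof (induction i arbitrary: k)
    case 0
    then show ?case by (simp add: v_def real_polynomial_function.intros(2))
  next
    case (Suc i)
    have "real_polynomial_function
        (\<lambda>t. det (\<chi> m j. if j = k then v t i $ m else matrix (C t) $ m $ j))"
      by (rule real_polynomial_function_det)
        (auto simp: matrix_def intro!: real_polynomial_function_If Suc polC)
    moreover have "v t (Suc i) $ k = (if k \<in> B
        then det (\<chi> m j. if j = k then v t i $ m else matrix (C t) $ m $ j) else 0)" for t
    proof -
      have "v t (Suc i) = T t (v t i)" by (simp add: v_def)
      then show ?thesis by (simp add: T_def cramer_numerator_def)
    qed
    ultimately show ?case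
      by (simp only: real_polynomial_function_If real_polynomial_function.intros(2))
  qed
  have d\<^sub>0: "d t\<^sub>0 \<noteq> 0"
    using d injC by blast
  have no_eig: "z = 0"
    if z: "z \<in> boundary_space B" and eig: "T t\<^sub>0 z = \<nu> *\<^sub>R z" and zx: "z \<bullet> axis x 1 = 0" for z \<nu>
  proof -
    define u where "u = cramer_numerator (matrix (C t\<^sub>0)) z"
    have Cu: "C t\<^sub>0 u = d t\<^sub>0 *\<^sub>R z" and Ru: "restriction B u = \<nu> *\<^sub>R z"
      using C_num[OF d\<^sub>0] eig by (auto simp: u_def T_def)
    have "u = 0"
    \<comment> \<open>If \<open>\<nu> = 0\<close>, the quadratic form of \<open>C t\<^sub>0\<close>
      vanishes at \<open>u\<close>. Otherwise \<open>u\<close> solves the eigenvalue problem with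
      eigenvalue \<open>d t\<^sub>0 / \<nu> - 1\<close> and vanishes at \<open>x\<close>.\<close>
    proof (cases "\<nu> = 0")
      case True
      have "u \<bullet> C t\<^sub>0 u = d t\<^sub>0 * (restriction B u \<bullet> z)"
        using z by (simp add: Cu restriction_inner restriction_boundary_space)
      then show ?thesis
        using posC'[of u] Ru True injC[of u] by (simp add: C_def)
    next
      case False
      have "laplacian E (w t\<^sub>0) u = (d t\<^sub>0 / \<nu> - 1) *\<^sub>R restriction B u"
        using Cu False by (simp add: C_def Ru algebra_simps)
      moreover have "u $ x = 0"
        using x zx arg_cong[OF Ru, of "\<lambda>f. f $ x"] by (simp add: inner_axis)
      ultimately show ?thesis
        using observableD[OF obs] by blast
    qed
    then show "z = 0"
      using Cu d\<^sub>0 linear_0[OF linC] by simp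
  qed
  have T_in: "T t z \<in> boundary_space B" for t z
    by (simp add: T_def)
  have "\<exists>n. \<forall>z\<in>boundary_space B. (\<forall>i<n. z \<bullet> (T t\<^sub>0 ^^ i) (axis x 1) = 0) \<longrightarrow> z = 0"
  proof (rule finite_krylov_separation)
    show "linear (T t\<^sub>0)"
      by (rule linT[OF d\<^sub>0])
    show "y \<bullet> T t\<^sub>0 z = T t\<^sub>0 y \<bullet> z" if "y \<in> boundary_space B" "z \<in> boundary_space B" for y z
      by (rule symT[OF d\<^sub>0 that])
    show "z = 0" if "z \<in> boundary_space B" "T t\<^sub>0 z = \<nu> *\<^sub>R z" "z \<bullet> axis x 1 = 0" for z \<nu>
      by (rule no_eig[OF that])
  qed (rule subspace_boundary_space b T_in)+
  then obtain n where n: "\<And>z. z \<in> boundary_space B \<Longrightarrow> \<forall>i<n. z \<bullet> v t\<^sub>0 i = 0 \<Longrightarrow> z = 0"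
    unfolding v_def by blast
  define G where "G t z = (\<Sum>i<n. (z \<bullet> v t i) *\<^sub>R v t i) + (z - restriction B z)" for t z
  have linG: "linear (G t)" for t
    unfolding G_def
    by (intro linear_compose_add linear_compose_sub linear_restriction linear_compose_sum ballI
        linear_ident linearI)
      (auto simp: inner_simps algebra_simps)
  have polG: "real_polynomial_function (\<lambda>t. G t z $ k)" for z k
    unfolding G_def inner_vec_def
    by (auto intro!: real_polynomial_function.intros(2-4) real_polynomial_function_sum polv)
  have kerG: "G t z = 0 \<longleftrightarrow> z \<in> boundary_space B \<and> (\<forall>i<n. z \<bullet> v t i = 0)" for t z
  proof
    assume "G t z = 0"
    \<comment> \<open>Pairing with \<open>z\<close> turns \<open>G t z\<close> into a sum of
      squares.\<close>
    then have "0 = z \<bullet> G t z" by simp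
    also have "\<dots> = (\<Sum>i<n. (z \<bullet> v t i)\<^sup>2) + (norm (z - restriction B z))\<^sup>2"
      unfolding power2_norm_eq_inner
      by (simp add: G_def inner_simps inner_sum_right power2_eq_square restriction_inner
          restriction_boundary_space)
    finally have "(\<Sum>i<n. (z \<bullet> v t i)\<^sup>2) = 0 \<and> (norm (z - restriction B z))\<^sup>2 = 0"
      using add_nonneg_eq_0_iff[of "\<Sum>i<n. (z \<bullet> v t i)\<^sup>2"] by (simp add: sum_nonneg)
    then show "z \<in> boundary_space B \<and> (\<forall>i<n. z \<bullet> v t i = 0)"
      using restriction_eq_iff[of B z] by (auto simp: sum_nonneg_eq_0_iff)
  next
    assume "z \<in> boundary_space B \<and> (\<forall>i<n. z \<bullet> v t i = 0)"
    then show "G t z = 0" by (simp add: G_def restriction_boundary_space)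
  qed
  have "observable E B (w t) x" if dt: "d t \<noteq> 0" and G: "\<And>z. G t z = 0 \<Longrightarrow> z = 0" for t
    unfolding observable_def
  proof (intro allI impI)
    fix \<mu> u
    assume eq: "laplacian E (w t) u = \<mu> *\<^sub>R restriction B u" and ux: "u $ x = 0"
    define f where "f = restriction B u"
    have f: "f \<in> boundary_space B" and fx: "f $ x = 0"
      using ux by (auto simp: f_def)
    have Cu: "C t u = (\<mu> + 1) *\<^sub>R f"
      by (simp add: C_def eq f_def algebra_simps)
    show "u = 0"
    proof (cases "\<mu> + 1 = 0")
      case True
      then show ?thesis using Cu d dt by simp
    next
      case False
      \<comment> \<open>Two vectors with equal image under the injective \<open>C t\<close>
        coincide; restricting them to \<open>B\<close> turns the equation for \<open>u\<close> into
        an eigenvalue equation for \<open>f\<close> under \<open>T t\<close>.\<close>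
      have "C t ((\<mu> + 1) *\<^sub>R cramer_numerator (matrix (C t)) f - d t *\<^sub>R u) = 0"
        by (simp add: linear_diff[OF linC] linear_scale[OF linC] C_num[OF dt] Cu)
      then have "(\<mu> + 1) *\<^sub>R cramer_numerator (matrix (C t)) f = d t *\<^sub>R u"
        using d dt by (metis eq_iff_diff_eq_0)
      from arg_cong[OF this, of "restriction B"] have "(\<mu> + 1) *\<^sub>R T t f = d t *\<^sub>R f"
        by (simp add: T_def f_def linear_scale[OF linear_restriction])
      from arg_cong[OF this, of "scaleR (inverse (\<mu> + 1))"]
      have Tf: "T t f = (d t / (\<mu> + 1)) *\<^sub>R f"
        using False by (simp add: divide_inverse_commute)
      have v_in: "v t i \<in> boundary_space B" for i
        using b by (cases i) (auto simp: v_def T_in)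
      \<comment> \<open>Symmetry moves \<open>T t\<close> onto \<open>f\<close>, which it only
        scales, so orthogonality passes from each Krylov vector to the next.\<close>
      have "f \<bullet> v t i = 0" for i
      proof (induction i)
        case 0
        then show ?case using fx by (simp add: v_def inner_axis)
      next
        case (Suc i)
        have "f \<bullet> v t (Suc i) = T t f \<bullet> v t i"
          using symT[OF dt f v_in] by (simp add: v_def)
        then show ?case using Suc by (simp add: Tf)
      qed
      then have "f = 0"
        using G[of f] kerG f by blast
      then show ?thesis using Cu d dt by simp
    qed
  qed
  then have "{t. \<not> observable E B (w t) x} \<subseteq>
      {t. \<exists>z. z \<noteq> 0 \<and> C t z = 0} \<union> {t. \<exists>z. z \<noteq> 0 \<and> G t z = 0}"
    using d by blast
  moreover have "finite {t. \<exists>z. z \<noteq> 0 \<and> C t z = 0}"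
    using finite_singular_parameters[OF linC polC injC] .
  moreover have "finite {t. \<exists>z. z \<noteq> 0 \<and> G t z = 0}"
    by (rule finite_singular_parameters[OF linG polG]) (use n kerG in blast)
  ultimately show ?thesis
    using finite_subset by blast
qed

section \<open>Growing an observable weight leaf by leaf\<close>

lemma laplacian_add_edge:
  assumes "p \<noteq> v" "{p, v} \<in> E" "w {p, v} = 0"
  shows "laplacian E (w({p, v} := s)) u =
    laplacian E w u + (s * (u $ p - u $ v)) *\<^sub>R (axis p 1 - axis v 1)"
proof -
  have "laplacian E (w({p, v} := s)) u $ y =
      laplacian E w u $ y + s * (u $ p - u $ v) * (axis p 1 $ y - axis v 1 $ y)" for y
  proof -
    \<comment> \<open>The edge occurs as two ordered pairs, one for each of the added terms.\<close>
    have "(if {y, z} \<in> E then (w({p, v} := s)) {y, z} * (u $ y - u $ z) else 0) =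
        (if {y, z} \<in> E then w {y, z} * (u $ y - u $ z) else 0) +
        ((if z = v then if y = p then s * (u $ p - u $ v) else 0 else 0) +
         (if z = p then if y = v then s * (u $ v - u $ p) else 0 else 0))" for z
      using assms by (auto simp: doubleton_eq_iff insert_commute)
    then have "laplacian E (w({p, v} := s)) u $ y = laplacian E w u $ y +
        ((if y = p then s * (u $ p - u $ v) else 0) + (if y = v then s * (u $ v - u $ p) else 0))"
      unfolding laplacian_nth by (simp add: sum.distrib)
    then show ?thesis
      using assms(1) by (auto simp: axis_def algebra_simps)
  qed
  then show ?thesis
    by (simp add: vec_eq_iff)
qed

lemma
  assumes supp: "\<And>e. w e \<noteq> 0 \<Longrightarrow> e \<subseteq> S"
  shows laplacian_supported_outside: "y \<notin> S \<Longrightarrow> laplacian E w u $ y = 0"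
    and laplacian_supported_restriction: "laplacian E w (restriction S u) = laplacian E w u"
proof -
  show "laplacian E w u $ y = 0" if "y \<notin> S"
    using supp that by (force simp: laplacian_def intro!: sum.neutral)
  have eq: "w {y, z} * (restriction S u $ y - restriction S u $ z) = w {y, z} * (u $ y - u $ z)" for y z
    using supp[of "{y, z}"] by auto
  show "laplacian E w (restriction S u) = laplacian E w u"
    by (simp only: laplacian_def eq)
qed

text \<open>For a weight supported on edges inside \<open>S\<close>, the equations at
  \<open>S\<close> involve only values on \<open>S\<close>; this is then observability of the part
  built so far.\<close>

definition observable_on ::
    "'v::finite set set \<Rightarrow> 'v set \<Rightarrow> ('v set \<Rightarrow> real) \<Rightarrow> 'v \<Rightarrow> 'v set \<Rightarrow> bool" where
  "observable_on E B w x S \<longleftrightarrow>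
    (\<forall>\<mu> u. (\<forall>y\<in>S. laplacian E w u $ y = \<mu> * restriction B u $ y) \<longrightarrow> u $ x = 0 \<longrightarrow>
      (\<forall>y\<in>S. u $ y = 0))"

lemma observable_on_UNIV: "observable_on E B w x UNIV \<longleftrightarrow> observable E B w x"
  by (simp add: observable_on_def observable_def vec_eq_iff)

text \<open>
  For a fixed eigenvalue \<open>\<mu>\<close> the solutions on \<open>S\<close> that satisfy all equations except the one
  at \<open>p\<close> form a space of dimension at most one, on which the defect at \<open>p\<close> is injective; this
  determines the weight \<open>s\<close> of the new edge.  Moreover such solutions exist only for finitely
  many \<open>\<mu>\<close>, because there are none for \<open>\<mu> = 0\<close>.
\<close>

lemma observable_on_add_leaf:
  fixes E :: "'v::finite set set"
  assumes x: "x \<in> S" and p: "p \<in> S" and v: "v \<notin> S" and edge: "{p, v} \<in> E"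
    and supp: "\<And>e. w e \<noteq> 0 \<Longrightarrow> e \<subseteq> S" and obs: "observable_on E B w x S"
  obtains s where "s > 0" "observable_on E B (w({p, v} := s)) x (insert v S)"
proof -
  \<comment> \<open>The defect of the equation at \<open>p\<close>, the only old equation that the
    new edge changes.\<close>
  define D where "D \<mu> u = laplacian E w u $ p - \<mu> * restriction B u $ p" for \<mu> u
  define bad where "bad s \<mu> u \<longleftrightarrow>
      (\<forall>y\<in>insert v S. laplacian E (w({p, v} := s)) u $ y = \<mu> * restriction B u $ y) \<and>
      u $ x = 0 \<and> (\<exists>y\<in>insert v S. u $ y \<noteq> 0)" for s \<mu> u
  have pv: "p \<noteq> v" and w_pv: "w {p, v} = 0"
    using p v supp by auto
  have L': "laplacian E (w({p, v} := s)) u =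
      laplacian E w u + (s * (u $ p - u $ v)) *\<^sub>R (axis p 1 - axis v 1)" for s u
    by (rule laplacian_add_edge) fact+
  have L_outside: "laplacian E w u $ y = 0" if "y \<notin> S" for u y
    by (rule laplacian_supported_outside[OF _ that]) (rule supp)
  have L_restriction: "laplacian E w (restriction S u) = laplacian E w u" for u
    by (rule laplacian_supported_restriction) (rule supp)
  have D_zero: "u $ y = 0"
    if eqs: "\<forall>y\<in>S - {p}. laplacian E w u $ y = \<mu> * restriction B u $ y"
      and "D \<mu> u = 0" "u $ x = 0" "y \<in> S"
    for \<mu> u y
  proof -
    have "laplacian E w u $ y = \<mu> * restriction B u $ y" if "y \<in> S" for y
    proof (cases "y = p")
      case True
      then show ?thesis using \<open>D \<mu> u = 0\<close> by (simp add: D_def)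
    next
      case False
      then show ?thesis
        using that eqs by blast
    qed
    then show ?thesis
      using obs that(3,4) unfolding observable_on_def by blast
  qed
  have bad_eq: "laplacian E w u $ y + s * (u $ p - u $ v) * (axis p 1 $ y - axis v 1 $ y) =
      \<mu> * restriction B u $ y" if "bad s \<mu> u" "y \<in> insert v S" for s \<mu> u y
  proof -
    have "laplacian E (w({p, v} := s)) u $ y = \<mu> * restriction B u $ y"
      using that unfolding bad_def by blast
    then show ?thesis by (simp only: L') simp
  qed
  have bad_S: "\<forall>y\<in>S - {p}. laplacian E w u $ y = \<mu> * restriction B u $ y" if "bad s \<mu> u" for s \<mu> u
  proof
    fix y assume "y \<in> S - {p}"
    with v bad_eq[OF that, of y] show "laplacian E w u $ y = \<mu> * restriction B u $ y"
      by (cases "y = v") (simp_all add: axis_def)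
  qed
  have bad_p: "D \<mu> u = s * (u $ v - u $ p)" if "bad s \<mu> u" for s \<mu> u
    using bad_eq[OF that, of p] p pv by (simp add: D_def axis_def algebra_simps)
  \<comment> \<open>The old weight has no edge at \<open>v\<close>, so the flux through the new edge
    alone balances the equation there. If \<open>v \<notin> B\<close>, the defect must
    vanish.\<close>
  have bad_v: "D \<mu> u = \<mu> * restriction B u $ v" if "bad s \<mu> u" for s \<mu> u
    using bad_eq[OF that, of v] bad_p[OF that] pv L_outside[OF v, of u]
    by (simp add: axis_def algebra_simps)
  have bad_x: "u $ x = 0" if "bad s \<mu> u" for s \<mu> u
    using that by (simp add: bad_def)
  have bad_D: "D \<mu> u \<noteq> 0" if bad: "bad s \<mu> u" and "s > 0" for s \<mu> u
  proof
    assume D: "D \<mu> u = 0"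
    have z: "u $ y = 0" if "y \<in> S" for y
      by (rule D_zero[OF bad_S[OF bad] D bad_x[OF bad] that])
    then have "u $ v = 0"
      using bad_p[OF bad] D p \<open>s > 0\<close> by simp
    with z show False
      using bad unfolding bad_def by blast
  qed
  have unique: "s = s'" if bad: "bad s \<mu> u" "bad s' \<mu> u'" and "s > 0" "s' > 0" for s s' \<mu> u u'
  proof -
    \<comment> \<open>This combination has zero defect, hence vanishes on \<open>S\<close>. The
      rescaled solutions thus agree at \<open>p\<close>, and by \<open>bad_v\<close> also at
      \<open>v\<close>; then \<open>bad_p\<close> determines the edge weight.\<close>
    define z where "z = D \<mu> u' *\<^sub>R u - D \<mu> u *\<^sub>R u'"
    have zn: "z $ y = D \<mu> u' * u $ y - D \<mu> u * u' $ y" for y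
      by (simp add: z_def)
    have lin: "laplacian E w z = D \<mu> u' *\<^sub>R laplacian E w u - D \<mu> u *\<^sub>R laplacian E w u'"
      by (simp add: z_def linear_diff[OF linear_laplacian] linear_scale[OF linear_laplacian])
    have "\<forall>y\<in>S - {p}. laplacian E w z $ y = \<mu> * restriction B z $ y"
      using bad_S[OF bad(1)] bad_S[OF bad(2)] by (auto simp: lin zn algebra_simps)
    moreover have "D \<mu> z = 0"
      by (simp add: D_def lin zn algebra_simps)
    moreover have "z $ x = 0"
      using bad_x[OF bad(1)] bad_x[OF bad(2)] by (simp add: z_def)
    ultimately have "z $ p = 0"
      using D_zero p by blast
    then have zp: "D \<mu> u' * u $ p = D \<mu> u * u' $ p"
      by (simp add: z_def)
    have "v \<in> B" "\<mu> \<noteq> 0"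
      using bad_v[OF bad(1)] bad_D[OF bad(1) \<open>s > 0\<close>] by (auto split: if_splits)
    then have zv: "D \<mu> u' * u $ v = D \<mu> u * u' $ v"
      using bad_v[OF bad(1)] bad_v[OF bad(2)] by simp
    have "s * (D \<mu> u' * u $ v - D \<mu> u' * u $ p) = D \<mu> u' * D \<mu> u"
      unfolding bad_p[OF bad(1)] by (simp add: algebra_simps)
    moreover have "s' * (D \<mu> u * u' $ v - D \<mu> u * u' $ p) = D \<mu> u' * D \<mu> u"
      unfolding bad_p[OF bad(2)] by (simp add: algebra_simps)
    ultimately have "s * (D \<mu> u' * u $ v - D \<mu> u' * u $ p) = s' * (D \<mu> u' * u $ v - D \<mu> u' * u $ p)"
      and "s * (D \<mu> u' * u $ v - D \<mu> u' * u $ p) \<noteq> 0"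
      using zp zv bad_D[OF bad(1) \<open>s > 0\<close>] bad_D[OF bad(2) \<open>s' > 0\<close>] by simp_all
    then show ?thesis by simp
  qed
  \<comment> \<open>A square system: row \<open>p\<close> holds the observation at \<open>x\<close>
    in place of the omitted equation, and the rows outside \<open>S\<close> force \<open>z\<close>
    to vanish there.\<close>
  define Q where "Q \<mu> z = (\<chi> y. if y = p then z $ x else if y \<in> S
      then laplacian E w z $ y - \<mu> * restriction B z $ y else z $ y)" for \<mu> and z :: "real ^ 'v"
  have linQ: "linear (Q \<mu>)" for \<mu>
    by (rule linearI)
      (auto simp: Q_def vec_eq_iff linear_add[OF linear_laplacian] linear_scale[OF linear_laplacian]
        algebra_simps)
  have polQ: "real_polynomial_function (\<lambda>\<mu>. Q \<mu> z $ y)" for z y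
    unfolding Q_def
    by (auto intro!: real_polynomial_function_If real_polynomial_function_diff
        real_polynomial_function.intros(2,4)
        real_polynomial_function.intros(1)[OF bounded_linear_ident])
  have injQ: "z = 0" if "Q 0 z = 0" for z
  proof -
    have Q: "(if y = p then z $ x else if y \<in> S then laplacian E w z $ y else z $ y) = 0" for y
      using arg_cong[OF that, of "\<lambda>f. f $ y"] by (simp add: Q_def split: if_splits)
    have zx: "z $ x = 0" using Q[of p] by simp
    have out: "laplacian E w z $ y = 0" if "y \<noteq> p" for y
      using Q[of y] that L_outside[of y] by (auto split: if_splits)
    \<comment> \<open>As the Laplacian sums to zero, for eigenvalue 0 the equation at
      \<open>p\<close> follows from the others.\<close>
    have "(\<Sum>y\<in>UNIV. laplacian E w z $ y) = laplacian E w z $ p"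
      using out by (subst sum.remove[of _ p]) auto
    then have "D 0 z = 0"
      by (simp add: D_def sum_laplacian)
    then have "z $ y = 0" if "y \<in> S" for y
      using D_zero[of z 0 y] that zx out by simp
    moreover have "z $ y = 0" if "y \<notin> S" for y
      using Q[of y] that p by (auto split: if_splits)
    ultimately show ?thesis by (auto simp: vec_eq_iff)
  qed
  define F where "F = {\<mu>. \<exists>z. z \<noteq> 0 \<and> Q \<mu> z = 0}"
  have "finite F"
    unfolding F_def using finite_singular_parameters[OF linQ polQ injQ] .
  have bad_F: "\<mu> \<in> F" if bad: "bad s \<mu> u" "s > 0" for s \<mu> u
  proof -
    have "Q \<mu> (restriction S u) = 0"
      using bad_S[OF bad(1)] bad_x[OF bad(1)]
      by (auto simp: Q_def vec_eq_iff L_restriction)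
    moreover have "restriction S u \<noteq> 0"
    proof
      assume 0: "restriction S u = 0"
      then have "laplacian E w u = 0"
        using L_restriction[of u] by (simp add: linear_0[OF linear_laplacian])
      moreover have "u $ p = 0"
        using arg_cong[OF 0, of "\<lambda>f. f $ p"] p by simp
      ultimately show False
        using bad_D[OF bad] by (auto simp: D_def split: if_splits)
    qed
    ultimately show ?thesis
      unfolding F_def by blast
  qed
  have "finite {s. s > 0 \<and> (\<exists>u. bad s \<mu> u)}" for \<mu>
  proof (cases "\<exists>s u. s > 0 \<and> bad s \<mu> u")
    case True
    then obtain s u where "s > 0" "bad s \<mu> u" by blast
    then have "{s. s > 0 \<and> (\<exists>u. bad s \<mu> u)} \<subseteq> {s}"
      using unique by blast
    then show ?thesis using finite_subset by blast
  next
    case False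
    then have "{s. s > 0 \<and> (\<exists>u. bad s \<mu> u)} = {}" by blast
    then show ?thesis by (metis finite.emptyI)
  qed
  \<comment> \<open>Each of the finitely many eigenvalues in \<open>F\<close> excludes at most one
    positive \<open>s\<close>.\<close>
  then have "finite (\<Union>\<mu>\<in>F. {s. s > 0 \<and> (\<exists>u. bad s \<mu> u)})"
    using \<open>finite F\<close> by blast
  then have "infinite ({0<..} - (\<Union>\<mu>\<in>F. {s. s > 0 \<and> (\<exists>u. bad s \<mu> u)}))"
    using Diff_infinite_finite infinite_Ioi by blast
  then obtain s where "s > 0" and s: "s \<notin> (\<Union>\<mu>\<in>F. {s. s > 0 \<and> (\<exists>u. bad s \<mu> u)})"
    by (metis (no_types, lifting) Diff_iff finite.emptyI greaterThan_iff equals0I)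
  have "\<not> bad s \<mu> u" for \<mu> u
    using s bad_F \<open>s > 0\<close> by blast
  then have "observable_on E B (w({p, v} := s)) x (insert v S)"
    unfolding observable_on_def bad_def by blast
  with \<open>s > 0\<close> show thesis using that by blast
qed

lemma connected_graph_boundary_edge:
  assumes "connected_graph E" and x: "x \<in> S" and "S \<noteq> UNIV"
  obtains p v where "p \<in> S" "v \<notin> S" "{p, v} \<in> E"
proof (rule ccontr)
  assume "\<not> thesis"
  then have closed: "v \<in> S" if "p \<in> S" "{p, v} \<in> E" for p v
    using that \<open>\<And>p v. p \<in> S \<Longrightarrow> v \<notin> S \<Longrightarrow> {p, v} \<in> E \<Longrightarrow> thesis\<close> by blast
  have "y \<in> S" if "(x, y) \<in> (adjacency E)\<^sup>*" for y
    using that by induction (auto simp: adjacency_def x closed)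
  then show False
    using assms(1,3) unfolding connected_graph_def by blast
qed

lemma ex_observable_weight:
  fixes E :: "'v::finite set set"
  assumes conn: "connected_graph E"
  obtains w where "\<And>e. w e \<ge> 0" "observable E B w x"
proof -
  define admissible where "admissible S w \<longleftrightarrow> (\<forall>e. w e \<ge> 0) \<and> (\<forall>e. w e \<noteq> 0 \<longrightarrow> e \<subseteq> S) \<and>
      observable_on E B w x S" for S w
  define \<S> where "\<S> = {S. x \<in> S \<and> (\<exists>w. admissible S w)}"
  \<comment> \<open>On a single vertex the premise \<open>u $ x = 0\<close> is already the
    conclusion.\<close>
  have "admissible {x} (\<lambda>_. 0)"
    by (simp add: admissible_def observable_on_def)
  then have "{x} \<in> \<S>"
    by (auto simp: \<S>_def)
  then obtain S where S: "S \<in> \<S>" and max: "\<And>R. R \<in> \<S> \<Longrightarrow> S \<subseteq> R \<Longrightarrow> S = R"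
    using finite_has_maximal[of \<S>] by auto
  obtain w where x: "x \<in> S" and w: "admissible S w"
    using S by (auto simp: \<S>_def)
  have "S = UNIV"
  proof (rule ccontr)
    assume "S \<noteq> UNIV"
    then obtain p v where pv: "p \<in> S" "v \<notin> S" "{p, v} \<in> E"
      using connected_graph_boundary_edge[OF conn x] by blast
    have supp: "\<And>e. w e \<noteq> 0 \<Longrightarrow> e \<subseteq> S" and obs: "observable_on E B w x S"
      using w by (auto simp: admissible_def)
    obtain s where "s > 0" "observable_on E B (w({p, v} := s)) x (insert v S)"
      using observable_on_add_leaf[OF x pv supp obs] by blast
    then have "admissible (insert v S) (w({p, v} := s))"
      using w pv by (auto simp: admissible_def)
    then have "insert v S \<in> \<S>"
      using x by (auto simp: \<S>_def)
    then show False
      using max[of "insert v S"] pv(2) by blast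
  qed
  with w show thesis
    using that by (auto simp: admissible_def observable_on_UNIV)
qed

section \<open>Perturbation to a weight observable at every boundary vertex\<close>

text \<open>On the line from the inductive weight \<open>a\<close> to a weight \<open>c\<close>
  observable at the new vertex, the old vertices are good at \<open>t = 0\<close> and the new one at
  \<open>t = 1\<close>. Each vertex therefore excludes finitely many \<open>t\<close>, and a small
  positive \<open>t\<close> is good for all.\<close>

lemma ex_weight_observable_everywhere:
  fixes E :: "'v::finite set set"
  assumes conn: "connected_graph E" and w: "weight E w" and "\<epsilon> > 0" and "S \<subseteq> B"
  shows "\<exists>w'. weight E w' \<and> (\<forall>e\<in>E. \<bar>w' e - w e\<bar> < \<epsilon>) \<and> (\<forall>x\<in>S. observable E B w' x)"
  using finite[of S] \<open>S \<subseteq> B\<close> \<open>\<epsilon> > 0\<close>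
proof (induction S arbitrary: \<epsilon> rule: finite_induct)
  case empty
  then show ?case using w by (intro exI[of _ w]) simp
next
  case (insert x S)
  then obtain a where a: "weight E a" "\<And>e. e \<in> E \<Longrightarrow> \<bar>a e - w e\<bar> < \<epsilon> / 2"
    "\<And>y. y \<in> S \<Longrightarrow> observable E B a y"
    using insert.IH[of "\<epsilon> / 2"] by auto
  obtain c where c: "\<And>e. c e \<ge> 0" "observable E B c x"
    using ex_observable_weight[OF conn] by blast
  define v where "v t = (\<lambda>e. a e + t * (c e - a e))" for t :: real
  have v0: "v 0 = a" and v1: "v 1 = c"
    by (auto simp: v_def)
  have "finite {t. \<not> observable E B (v t) y}" if "y \<in> insert x S" for y
  proof -
    have yB: "y \<in> B" using that insert.prems by blast
    have "\<exists>t\<^sub>0. (\<forall>e\<in>E. v t\<^sub>0 e \<ge> 0) \<and> observable E B (v t\<^sub>0) y"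
    proof (cases "y = x")
      case True
      then show ?thesis using c v1 by (intro exI[of _ 1]) simp
    next
      case False
      then show ?thesis
        using a that v0 by (intro exI[of _ 0]) (auto simp: weight_def less_imp_le)
    qed
    then obtain t\<^sub>0 where t\<^sub>0: "\<And>e. e \<in> E \<Longrightarrow> v t\<^sub>0 e \<ge> 0" "observable E B (v t\<^sub>0) y"
      by blast
    show ?thesis
      unfolding v_def
    proof (rule finite_unobservable_on_line[OF yB])
      show "a e + t\<^sub>0 * (c e - a e) \<ge> 0" if "e \<in> E" for e
        using t\<^sub>0(1)[OF that] by (simp add: v_def)
      show "observable E B (\<lambda>e. a e + t\<^sub>0 * (c e - a e)) y"
        using t\<^sub>0(2) by (simp add: v_def)
    qed
  qed
  then have fin: "finite (\<Union>y\<in>insert x S. {t. \<not> observable E B (v t) y})"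
    using insert.hyps(1) by (intro finite_UN_I) auto
  \<comment> \<open>The inserted 1 keeps \<open>K\<close> well defined and positive even if
    \<open>E\<close> is empty.\<close>
  define K where "K = Max (insert 1 ((\<lambda>e. \<bar>c e - a e\<bar>) ` E))"
  have K: "K \<ge> 1" "\<And>e. e \<in> E \<Longrightarrow> \<bar>c e - a e\<bar> \<le> K"
    by (auto simp: K_def)
  \<comment> \<open>The bound 1 keeps the convex combination positive; the other one keeps the move
    below \<open>\<epsilon> / 2\<close>, the rest being spent by the induction hypothesis.\<close>
  define \<delta> where "\<delta> = min 1 (\<epsilon> / (2 * K))"
  have "\<delta> > 0"
    using K(1) insert.prems by (simp add: \<delta>_def)
  then have "infinite {0<..<\<delta>}"
    by (rule infinite_Ioo)
  then have "\<not> {0<..<\<delta>} \<subseteq> (\<Union>y\<in>insert x S. {t. \<not> observable E B (v t) y})"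
    using fin finite_subset by blast
  then obtain t where "t \<in> {0<..<\<delta>}"
    and good: "t \<notin> (\<Union>y\<in>insert x S. {t. \<not> observable E B (v t) y})"
    by blast
  then have t: "0 < t" "t < \<delta>"
    by auto
  have "v t e > 0" if "e \<in> E" for e
  proof -
    have "v t e = (1 - t) * a e + t * c e"
      by (simp add: v_def algebra_simps)
    moreover have "(1 - t) * a e > 0" "t * c e \<ge> 0"
      using t a(1) c(1) that by (auto simp: weight_def \<delta>_def)
    ultimately show ?thesis by simp
  qed
  moreover have "\<bar>v t e - w e\<bar> < \<epsilon>" if "e \<in> E" for e
  proof -
    have "\<bar>t * (c e - a e)\<bar> \<le> t * K"
      using K(2)[OF that] t(1) by (simp add: abs_mult)
    also have "\<dots> < \<epsilon> / (2 * K) * K"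
      using t(2) K(1) by (intro mult_strict_right_mono) (auto simp: \<delta>_def)
    also have "\<dots> = \<epsilon> / 2"
      using K(1) by simp
    finally show ?thesis
      using a(2)[OF that] unfolding v_def by linarith
  qed
  ultimately show ?case
    using good by (intro exI[of _ "v t"]) (simp add: weight_def)
qed

section \<open>From observability back to the Steklov spectrum\<close>

text \<open>The Laplacian of a harmonic extension is its normal derivative on \<open>B\<close> and 0
  elsewhere; conversely, a solution \<open>u\<close> is harmonic off \<open>B\<close>, hence by
  uniqueness the extension of its restriction.\<close>

lemma steklov_eigenspace_iff:
  fixes E :: "'v::finite set set"
  assumes "connected_graph E" "weight E w" "B \<noteq> {}"
  shows "f \<in> steklov_eigenspace E B w \<mu> \<longleftrightarrow>
    (\<exists>u. restriction B u = f \<and> laplacian E w u = \<mu> *\<^sub>R restriction B u)"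
proof -
  define u where "u = harmonic_extension E B w f"
  have ex1: "\<exists>!u. is_harmonic_extension E B w f u"
    using harmonic_extension_ex1[OF assms] .
  have u: "is_harmonic_extension E B w f u"
    unfolding u_def harmonic_extension_def using theI'[OF ex1] .
  have op: "steklov_operator E B w f = laplacian E w u"
    using u by (auto simp: steklov_operator_def u_def[symmetric] normal_derivative_def
        is_harmonic_extension_def vec_eq_iff laplacian_def)
  show ?thesis
  proof
    assume "f \<in> steklov_eigenspace E B w \<mu>"
    then have f: "f \<in> boundary_space B" "laplacian E w u = \<mu> *\<^sub>R f"
      by (auto simp: steklov_eigenspace_def op)
    have "restriction B u = f"
      using u f(1) by (auto simp: is_harmonic_extension_def boundary_space_def vec_eq_iff)
    then show "\<exists>u. restriction B u = f \<and> laplacian E w u = \<mu> *\<^sub>R restriction B u"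
      using f(2) by blast
  next
    assume "\<exists>u. restriction B u = f \<and> laplacian E w u = \<mu> *\<^sub>R restriction B u"
    then obtain z where z: "restriction B z = f" "laplacian E w z = \<mu> *\<^sub>R f"
      by blast
    then have "is_harmonic_extension E B w f z"
      unfolding is_harmonic_extension_def z(2) by (auto simp: z(1)[symmetric])
    then have "z = u" using u ex1 by blast
    then show "f \<in> steklov_eigenspace E B w \<mu>"
      using z by (auto simp: steklov_eigenspace_def op)
  qed
qed

lemma subspace_steklov_eigenspace:
  fixes E :: "'v::finite set set"
  assumes "connected_graph E" "weight E w" "B \<noteq> {}"
  shows "subspace (steklov_eigenspace E B w \<mu>)"
proof -
  have "subspace {u. laplacian E w u - \<mu> *\<^sub>R restriction B u = 0}"
    by (intro linear_subspace_kernel linear_compose_sub linear_laplacian linear_compose_scale_right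
        linear_restriction)
  then have "subspace (restriction B ` {u. laplacian E w u - \<mu> *\<^sub>R restriction B u = 0})"
    by (rule linear_subspace_image[OF linear_restriction])
  moreover have "restriction B ` {u. laplacian E w u - \<mu> *\<^sub>R restriction B u = 0} =
      steklov_eigenspace E B w \<mu>"
    by (auto simp: steklov_eigenspace_iff[OF assms])
  ultimately show ?thesis by simp
qed

theorem corollary1p3:
  fixes E :: "'v::finite set set" and B :: "'v set"
    and w :: "'v set \<Rightarrow> real" and \<epsilon> :: real
  assumes "simple_graph E" and "connected_graph E" and "B \<noteq> {}"
    and "weight E w" and "\<epsilon> > 0"
  shows "\<exists>w'. weight E w' \<and> (\<forall>e\<in>E. \<bar>w' e - w e\<bar> < \<epsilon>) \<and>
    (\<forall>\<mu>. steklov_eigenvalue E B w' \<mu> \<longrightarrow> simple_steklov_eigenvalue E B w' \<mu>) \<and>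
    (\<forall>f. steklov_eigenfunction E B w' f \<longrightarrow> (\<forall>x\<in>B. f $ x \<noteq> 0))"
proof -
  obtain w' where *: "weight E w' \<and> (\<forall>e\<in>E. \<bar>w' e - w e\<bar> < \<epsilon>) \<and> (\<forall>x\<in>B. observable E B w' x)"
    using ex_weight_observable_everywhere[OF assms(2,4,5) order_refl] by (rule exE)
  then have w': "weight E w'" "\<forall>e\<in>E. \<bar>w' e - w e\<bar> < \<epsilon>"
    and obs: "\<And>x. x \<in> B \<Longrightarrow> observable E B w' x"
    by simp_all
  note eigenspace = steklov_eigenspace_iff[OF assms(2) w'(1) assms(3)]
  note subspace = subspace_steklov_eigenspace[OF assms(2) w'(1) assms(3)]
  have nonvanishing: "f = 0" if f: "f \<in> steklov_eigenspace E B w' \<mu>" and x: "x \<in> B" "f $ x = 0" for f \<mu> x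
  proof -
    obtain u where u: "restriction B u = f" "laplacian E w' u = \<mu> *\<^sub>R restriction B u"
      using f[unfolded eigenspace] by blast
    have "u $ x = 0"
      using x arg_cong[OF u(1), of "\<lambda>f. f $ x"] by simp
    then have "u = 0"
      by (rule observableD[OF obs[OF x(1)] u(2)])
    then show "f = 0"
      using u(1) by (simp add: linear_0[OF linear_restriction])
  qed
  have "simple_steklov_eigenvalue E B w' \<mu>" if eig: "steklov_eigenvalue E B w' \<mu>" for \<mu>
  proof -
    let ?V = "steklov_eigenspace E B w' \<mu>"
    obtain f where f: "f \<in> ?V" "f \<noteq> 0"
      using eig by (auto simp: steklov_eigenvalue_def)
    obtain x where x: "x \<in> B" using assms(3) by blast
    \<comment> \<open>Since \<open>f\<close> does not vanish at \<open>x\<close>, a multiple of it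
      can be subtracted from \<open>g\<close> to obtain an element of the eigenspace vanishing at
      \<open>x\<close>.\<close>
    have "g \<in> span {f}" if "g \<in> ?V" for g
    proof -
      have "g - (g $ x / f $ x) *\<^sub>R f \<in> ?V"
        by (intro subspace_diff[OF subspace] subspace_scale[OF subspace] that f(1))
      moreover have "(g - (g $ x / f $ x) *\<^sub>R f) $ x = 0"
        using nonvanishing[OF f(1) x] f(2) by auto
      ultimately have "g - (g $ x / f $ x) *\<^sub>R f = 0"
        by (rule nonvanishing[OF _ x])
      then have "g = (g $ x / f $ x) *\<^sub>R f"
        by simp
      then show ?thesis
        using span_mul[OF span_base[of f "{f}"], of "g $ x / f $ x"] by simp
    qed
    moreover have "span {f} \<subseteq> ?V"
      by (rule span_minimal[OF _ subspace]) (simp add: f(1))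
    ultimately have "?V = span {f}" by blast
    then show ?thesis
      using eig f(2) by (simp add: simple_steklov_eigenvalue_def)
  qed
  moreover have "\<forall>x\<in>B. f $ x \<noteq> 0" if eig: "steklov_eigenfunction E B w' f" for f
  proof (intro ballI notI)
    fix x assume "x \<in> B" "f $ x = 0"
    moreover obtain \<mu> where "f \<in> steklov_eigenspace E B w' \<mu>" "f \<noteq> 0"
      using eig unfolding steklov_eigenfunction_def by blast
    ultimately show False
      using nonvanishing by blast
  qed
  ultimately show ?thesis
    using w' by (intro exI[of _ w']) simp
qed

end
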